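(* Let $f=h+\overline{g}$ be a harmonic mapping in $\mathbb{D}$ such that $|f(z)|\le 1$ for all $z\in\mathbb{D}$, where $h(z)=\sum_{k=0}^{\infty}a_kz^k$ and $g(z)=\sum_{k=1}^{\infty}b_kz^k$ are analytic in $\mathbb{D}$. Then for any real $p\ge 1$ and any $0\le r<1$, $$\sum_{k=1}^{\infty}\left(|a_k|^p+|b_k|^p\right)^{1/p}r^k\le \max\{2^{(1/p)-1/2},1\}\,\sqrt{1-|a_0|^2}\,\frac{r}{\sqrt{1-r^2}}.$$
   Context: $\mathbb{D}=\{z\in\mathbb{C}:|z|<1\}$ is the open unit disk. A harmonic mapping in $\mathbb{D}$ means a complex-valued harmonic function in $\mathbb{D}$ (not assumed injective). *)

theory Defs
  imports "HOL-Complex_Analysis.Complex_Analysis"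
begin

(* A complex-valued function of one complex variable z = x + iy is harmonic on an open set S if
   it is twice continuously differentiable in the real sense on S and f_xx + f_yy = 0 there.
   A function with partial derivatives fx, fy has real derivative w = u + iv |-> u fx + v fy. *)
definition has_partials_on ::
  "(complex \<Rightarrow> complex) \<Rightarrow> (complex \<Rightarrow> complex) \<Rightarrow> (complex \<Rightarrow> complex) \<Rightarrow> complex set \<Rightarrow> bool"
  where "has_partials_on f fx fy S \<longleftrightarrow>
    (\<forall>z\<in>S. (f has_derivative (\<lambda>w. Re w *\<^sub>R fx z + Im w *\<^sub>R fy z)) (at z))"

definition harmonic_mapping_on :: "(complex \<Rightarrow> complex) \<Rightarrow> complex set \<Rightarrow> bool"
  where "harmonic_mapping_on f S \<longleftrightarrow> open S \<and>
    (\<exists>fx fy fxx fxy fyx fyy.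
      has_partials_on f fx fy S \<and> has_partials_on fx fxx fxy S \<and> has_partials_on fy fyx fyy S \<and>
      continuous_on S fxx \<and> continuous_on S fxy \<and> continuous_on S fyx \<and> continuous_on S fyy \<and>
      (\<forall>z\<in>S. fxx z + fyy z = 0))"

lemma has_partials_on_holomorphic_add_cnj:
  assumes S: "open S" and h: "h holomorphic_on S" and g: "g holomorphic_on S"
    and f: "\<And>z. z \<in> S \<Longrightarrow> f z = h z + cnj (g z)"
  shows "has_partials_on f (\<lambda>z. deriv h z + cnj (deriv g z))
           (\<lambda>z. \<i> * deriv h z + cnj (\<i> * deriv g z)) S"
  unfolding has_partials_on_def
proof
  fix z assume z: "z \<in> S"
  have 1: "(h has_derivative (\<lambda>w. deriv h z * w)) (at z)"
    "(g has_derivative (\<lambda>w. deriv g z * w)) (at z)"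
    using holomorphic_derivI[OF h S z] holomorphic_derivI[OF g S z]
    by (simp_all add: has_field_derivative_def)
  have 2: "((\<lambda>z. h z + cnj (g z)) has_derivative (\<lambda>w. deriv h z * w + cnj (deriv g z * w))) (at z)"
    by (intro has_derivative_add has_derivative_cnj 1)
  have 3: "(\<lambda>w. deriv h z * w + cnj (deriv g z * w)) =
    (\<lambda>w. Re w *\<^sub>R (deriv h z + cnj (deriv g z)) + Im w *\<^sub>R (\<i> * deriv h z + cnj (\<i> * deriv g z)))"
    by (auto simp: fun_eq_iff complex_eq_iff algebra_simps)
  show "(f has_derivative (\<lambda>w. Re w *\<^sub>R (deriv h z + cnj (deriv g z)) +
      Im w *\<^sub>R (\<i> * deriv h z + cnj (\<i> * deriv g z)))) (at z)"
    using has_derivative_transform_within_open[OF 2 S z] f 3 by simp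
qed

lemma harmonic_mapping_on_holomorphic_add_cnj:
  assumes S: "open S" and h: "h holomorphic_on S" and g: "g holomorphic_on S"
    and f: "\<And>z. z \<in> S \<Longrightarrow> f z = h z + cnj (g z)"
  shows "harmonic_mapping_on f S"
proof -
  let ?h = "deriv h" and ?g = "deriv g"
  let ?ih = "\<lambda>z. \<i> * deriv h z" and ?ig = "\<lambda>z. \<i> * deriv g z"
  have hol: "?h holomorphic_on S" "?g holomorphic_on S" "?ih holomorphic_on S" "?ig holomorphic_on S"
    using S h g by (auto intro!: holomorphic_intros)
  have hol': "deriv ?h holomorphic_on S" "deriv ?g holomorphic_on S"
      "deriv ?ih holomorphic_on S" "deriv ?ig holomorphic_on S"
    using S hol by (auto intro: holomorphic_deriv)
  note c = this[THEN holomorphic_on_imp_continuous_on]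
  have d: "deriv ?ih z = \<i> * deriv ?h z" "deriv ?ig z = \<i> * deriv ?g z" if "z \<in> S" for z
    using that hol S by (auto intro!: deriv_cmult simp: holomorphic_on_imp_differentiable_at)
  show ?thesis
    unfolding harmonic_mapping_on_def
  proof (intro conjI exI S)
    show "has_partials_on f (\<lambda>z. ?h z + cnj (?g z)) (\<lambda>z. ?ih z + cnj (?ig z)) S"
      by (rule has_partials_on_holomorphic_add_cnj[OF S h g f])
    show "has_partials_on (\<lambda>z. ?h z + cnj (?g z)) (\<lambda>z. deriv ?h z + cnj (deriv ?g z))
      (\<lambda>z. \<i> * deriv ?h z + cnj (\<i> * deriv ?g z)) S"
      by (rule has_partials_on_holomorphic_add_cnj[OF S hol(1,2) refl])
    show "has_partials_on (\<lambda>z. ?ih z + cnj (?ig z)) (\<lambda>z. deriv ?ih z + cnj (deriv ?ig z))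
      (\<lambda>z. \<i> * deriv ?ih z + cnj (\<i> * deriv ?ig z)) S"
      by (rule has_partials_on_holomorphic_add_cnj[OF S hol(3,4) refl])
  qed (use c in \<open>auto intro!: continuous_intros simp: d\<close>)
qed

end

theory Submission
  imports Defs
begin

text \<open>
  The inequality combines three facts. The quantity \<open>(x\<^sup>p + y\<^sup>p)\<^bsup>1/p\<^esup>\<close> is at most
  \<open>max {2\<^bsup>1/p - 1/2\<^esup>, 1}\<close> times the Euclidean norm of \<open>(x, y)\<close> (\<open>lp_le_l2_pair\<close>).
  The Cauchy--Schwarz inequality then separates the coefficients from the powers of \<open>r\<close>, and the
  powers contribute \<open>\<Sum>k\<ge>1. r\<^bsup>2k\<^esup> = r\<^sup>2 / (1 - r\<^sup>2)\<close>. What remains is the Bessel inequality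
  \<open>\<Sum>k. \<bar>a\<^sub>k\<bar>\<^sup>2 + \<bar>b\<^sub>k\<bar>\<^sup>2 \<le> 1\<close> with \<open>b\<^sub>0 = 0\<close> (\<open>harmonic_bessel\<close>): it holds because on a circle of radius
  \<open>\<rho>\<close> the numbers \<open>a\<^sub>k \<rho>\<^sup>k\<close> and the conjugates of \<open>b\<^sub>k \<rho>\<^sup>k\<close> are the Fourier coefficients of \<open>f\<close>,
  at the frequencies \<open>k\<close> and \<open>-k\<close> respectively, and the mean of \<open>\<bar>f\<bar>\<^sup>2\<close> over that circle is at most \<open>1\<close>.

  Instead of integrating over the circle one can average over roots of unity. For a
  trigonometric polynomial of degree \<open>n\<close> the average of its squared modulus over more than \<open>2n\<close>
  equally spaced points is exactly the sum of the squared moduli of its coefficients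
  (\<open>discrete_parseval\<close>), so that the only limits are those of the partial sums, which
  approximate \<open>f\<close> uniformly on the circle, and of \<open>\<rho>\<close> tending to \<open>1\<close>.
\<close>

section \<open>Comparing p-norms on pairs\<close>

text \<open>Factor out \<open>q - 1\<close> of the powers, which are monotone: \<open>s\<^sup>q = s s\<^bsup>q-1\<^esup> \<le> s (s + t)\<^bsup>q-1\<^esup>\<close>.\<close>

lemma powr_add_powr_le_powr_add:
  fixes s t q :: real
  assumes "s \<ge> 0" "t \<ge> 0" "q \<ge> 1"
  shows "s powr q + t powr q \<le> (s + t) powr q"
proof -
  have split: "u powr q = u * u powr (q - 1)" if "u \<ge> 0" for u :: real
    using that by (cases "u = 0") (auto simp: powr_mult_base)
  have "s powr q + t powr q = s * s powr (q - 1) + t * t powr (q - 1)"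
    using assms by (simp add: split)
  also have "\<dots> \<le> s * (s + t) powr (q - 1) + t * (s + t) powr (q - 1)"
    using assms by (intro add_mono mult_left_mono powr_mono2) auto
  also have "\<dots> = (s + t) powr q"
    using assms by (simp add: split[of "s + t"] algebra_simps)
  finally show ?thesis .
qed

text \<open>This is concavity of \<open>u \<mapsto> u\<^sup>q\<close> for \<open>q \<le> 1\<close> at the midpoint \<open>m\<close> of \<open>s\<close> and \<open>t\<close>; the tangent
  inequality at \<open>m\<close> is \<open>s\<^sup>q m\<^bsup>1-q\<^esup> \<le> q s + (1 - q) m\<close>, an instance of Young's inequality.\<close>

lemma powr_add_powr_le_midpoint:
  fixes s t q :: real
  assumes "s \<ge> 0" "t \<ge> 0" "0 \<le> q" "q \<le> 1"
  shows "s powr q + t powr q \<le> 2 * ((s + t) / 2) powr q"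
proof (cases "s + t = 0")
  case True
  then show ?thesis using assms by (simp add: add_nonneg_eq_0_iff)
next
  case False
  define m where "m = (s + t) / 2"
  have m: "m > 0" using False assms by (simp add: m_def)
  have young: "u powr q * m powr (1 - q) \<le> q * u + (1 - q) * m" if "u \<ge> 0" for u
    using assms m that Youngs_inequality_0[of q "1 - q" u m] by (cases "u = 0") auto
  have "(s powr q + t powr q) * m powr (1 - q) \<le> q * (s + t) + 2 * (1 - q) * m"
    using young[of s] young[of t] assms by (simp add: algebra_simps)
  also have "\<dots> = 2 * m" by (simp add: m_def field_simps)
  also have "\<dots> = 2 * m powr q * m powr (1 - q)"
    using m by (simp flip: powr_add)
  finally show ?thesis using m by (simp add: m_def[symmetric])
qed

text \<open>With \<open>q = p/2\<close>, \<open>s = x\<^sup>2\<close> and \<open>t = y\<^sup>2\<close>, the case \<open>p \<ge> 2\<close> is superadditivity and the case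
  \<open>p \<le> 2\<close> is concavity. The two constants are attained at \<open>y = 0\<close> and at \<open>x = y\<close>.\<close>

lemma lp_le_l2_pair:
  fixes x y p :: real
  assumes "x \<ge> 0" "y \<ge> 0" "p > 0"
  shows "(x powr p + y powr p) powr (1 / p)
    \<le> max (2 powr (1 / p - 1 / 2)) 1 * sqrt (x\<^sup>2 + y\<^sup>2)"
proof -
  have sq: "u powr p = (u\<^sup>2) powr (p / 2)" if "u \<ge> 0" for u :: real
    using that by (cases "u = 0") (auto simp: powr_powr simp flip: powr_numeral)
  have root: "(c powr (p / 2)) powr (1 / p) = sqrt c" if "c \<ge> 0" for c :: real
    using that assms by (simp add: powr_powr powr_half_sqrt)
  show ?thesis
  proof (cases "p \<ge> 2")
    case True
    have "(x powr p + y powr p) powr (1 / p) \<le> ((x\<^sup>2 + y\<^sup>2) powr (p / 2)) powr (1 / p)"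
      using assms True powr_add_powr_le_powr_add[of "x\<^sup>2" "y\<^sup>2" "p / 2"]
      by (intro powr_mono2) (auto simp: sq)
    also have "\<dots> = 1 * sqrt (x\<^sup>2 + y\<^sup>2)" by (simp add: root)
    also have "\<dots> \<le> max (2 powr (1 / p - 1 / 2)) 1 * sqrt (x\<^sup>2 + y\<^sup>2)"
      by (intro mult_right_mono) auto
    finally show ?thesis .
  next
    case False
    have "(x powr p + y powr p) powr (1 / p)
        \<le> (2 * ((x\<^sup>2 + y\<^sup>2) / 2) powr (p / 2)) powr (1 / p)"
      using assms False powr_add_powr_le_midpoint[of "x\<^sup>2" "y\<^sup>2" "p / 2"]
      by (intro powr_mono2) (auto simp: sq)
    also have "\<dots> = 2 powr (1 / p) * sqrt ((x\<^sup>2 + y\<^sup>2) / 2)"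
      by (simp add: powr_mult root)
    also have "\<dots> = 2 powr (1 / p - 1 / 2) * sqrt (x\<^sup>2 + y\<^sup>2)"
      by (simp add: powr_diff powr_half_sqrt real_sqrt_divide)
    also have "\<dots> \<le> max (2 powr (1 / p - 1 / 2)) 1 * sqrt (x\<^sup>2 + y\<^sup>2)"
      by (intro mult_right_mono) auto
    finally show ?thesis .
  qed
qed

section \<open>A Bessel inequality for bounded harmonic mappings\<close>

text \<open>The powers \<open>1, u, \<dots>, u\<^bsup>N-1\<^esup>\<close> are orthogonal for the average over the \<open>N\<close>-th roots of
  unity, because the off-diagonal products sum to geometric series whose ratio is a root of unity
  other than \<open>1\<close>.\<close>

lemma discrete_parseval:
  fixes d :: "nat \<Rightarrow> complex" and N :: nat
  defines "u \<equiv> \<lambda>j. cis (2 * pi * real j / real N)"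
  assumes "N > 0"
  shows "(\<Sum>j<N. (cmod (\<Sum>m<N. d m * u j ^ m))\<^sup>2) = real N * (\<Sum>m<N. (cmod (d m))\<^sup>2)"
proof -
  have orth: "(\<Sum>j<N. u j ^ m * cnj (u j ^ l)) = (if l = m then of_nat N else 0)"
    if "m < N" "l < N" for m l
  proof -
    define x where "x = u m * cnj (u l)"
    have cis_u: "u j ^ i = u i ^ j" for i j
      unfolding u_def Complex.DeMoivre by (simp add: mult_ac)
    have eq: "u j ^ m * cnj (u j ^ l) = x ^ j" for j
      unfolding x_def by (simp add: cis_u[of j] power_mult_distrib)
    have inv: "u l * cnj (u l) = 1"
      by (simp add: u_def flip: complex_norm_square)
    have uN: "u i ^ N = 1" for i
      using assms by (simp add: u_def Complex.DeMoivre cis_multiple_2pi)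
    have "x ^ N = 1" 
      by (simp add: x_def power_mult_distrib uN flip: complex_cnj_power)
    moreover have "x = 1 \<longleftrightarrow> l = m"
    proof
      assume "x = 1"
      then have "u m * (u l * cnj (u l)) = u l" by (simp add: x_def mult_ac)
      then have "u m = u l" by (simp add: inv)
      then show "l = m"
        using complex_root_unity_eq[of N m l] that assms
        by (simp add: u_def cis_conv_exp mult_ac)
    qed (use inv in \<open>auto simp: x_def\<close>)
    ultimately show ?thesis
      unfolding eq sum_gp_strict by auto
  qed
  have "complex_of_real (\<Sum>j<N. (cmod (\<Sum>m<N. d m * u j ^ m))\<^sup>2)
      = (\<Sum>j<N. \<Sum>m<N. \<Sum>l<N. d m * cnj (d l) * (u j ^ m * cnj (u j ^ l)))"
    by (simp add: complex_norm_square sum_product mult_ac del: of_real_power)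
  also have "\<dots> = (\<Sum>m<N. \<Sum>l<N. d m * cnj (d l) * (\<Sum>j<N. u j ^ m * cnj (u j ^ l)))"
    by (subst sum.swap, rule sum.cong[OF refl], subst sum.swap) (simp add: sum_distrib_left)
  also have "\<dots> = (\<Sum>m<N. d m * cnj (d m) * of_nat N)"
    by (intro sum.cong refl) (simp add: orth if_distrib del: complex_cnj_power cong: if_cong)
  also have "\<dots> = complex_of_real (real N * (\<Sum>m<N. (cmod (d m))\<^sup>2))"
    by (simp add: complex_norm_square sum_distrib_left mult_ac del: of_real_power)
  finally show ?thesis unfolding of_real_eq_iff .
qed

text \<open>On the circle of radius \<open>\<rho>\<close> the harmonic polynomial is, up to the unimodular factor \<open>u\<^sup>n\<close>,
  a polynomial in \<open>u = z / \<rho>\<close> of degree at most \<open>2n\<close>, to which the discrete Parseval identity applies.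
  With \<open>b\<^sub>0 = 0\<close> every frequency carries a single coefficient; otherwise the constant term
  would be \<open>a\<^sub>0\<close> plus the conjugate of \<open>b\<^sub>0\<close>.\<close>

lemma harmonic_polynomial_bessel:
  fixes a b :: "nat \<Rightarrow> complex" and n :: nat and \<rho> B :: real
  assumes b0: "b 0 = 0" and \<rho>: "\<rho> \<ge> 0"
    and B: "\<And>z. cmod z = \<rho> \<Longrightarrow>
      cmod ((\<Sum>k<Suc n. a k * z ^ k) + cnj (\<Sum>k<Suc n. b k * z ^ k)) \<le> B"
  shows "(\<Sum>k<Suc n. ((cmod (a k))\<^sup>2 + (cmod (b k))\<^sup>2) * (\<rho>\<^sup>2) ^ k) \<le> B\<^sup>2"
proof -
  define N where "N = n + Suc n"
  define d where "d m = (if m < n then cnj (b (n - m)) * \<rho> ^ (n - m)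
    else a (m - n) * \<rho> ^ (m - n))" for m
  have split: "(\<Sum>m<N. F m) = (\<Sum>k<Suc n. F (n + k)) + (\<Sum>k<n. F (n - Suc k))"
    for F :: "nat \<Rightarrow> 'c::comm_monoid_add"
    using sum.nat_diff_reindex[of F n] sum.atLeastLessThan_concat[of 0 n N F]
      sum.shift_bounds_nat_ivl[of F 0 n "Suc n"]
    by (simp add: N_def lessThan_atLeast0 add_ac del: sum.op_ivl_Suc)
  have shift: "(\<Sum>k<Suc n. G k) = (\<Sum>k<n. G (Suc k))" if "G 0 = 0"
    for G :: "nat \<Rightarrow> 'c::comm_monoid_add"
    using that by (simp add: sum.lessThan_Suc_shift del: sum.lessThan_Suc)
  have bound: "cmod (\<Sum>m<N. d m * u ^ m) \<le> B" if u: "cmod u = 1" for u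
  proof -
    have inv: "cnj u * u = 1"
      using u by (metis complex_norm_square mult.commute of_real_1 power_one)
    have cancel: "u ^ n * cnj u ^ Suc k = u ^ (n - Suc k)" if "k < n" for k
    proof -
      have "u ^ n = u ^ (n - Suc k) * u ^ Suc k"
        using that by (simp del: power_Suc flip: power_add)
      then show ?thesis
        by (simp add: mult.assoc inv mult.commute[of u "cnj u"] flip: power_mult_distrib del: power_Suc)
    qed
    have "(\<Sum>m<N. d m * u ^ m)
        = (\<Sum>k<Suc n. a k * \<rho> ^ k * u ^ (n + k))
          + (\<Sum>k<n. cnj (b (Suc k)) * \<rho> ^ Suc k * u ^ (n - Suc k))"
      unfolding split by (auto simp: d_def intro!: arg_cong2[of _ _ _ _ "(+)"] sum.cong)
    also have "\<dots> = u ^ n * ((\<Sum>k<Suc n. a k * (\<rho> * u) ^ k)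
        + (\<Sum>k<n. cnj (b (Suc k) * (\<rho> * u) ^ Suc k)))"
      unfolding distrib_left sum_distrib_left
      by (intro arg_cong2[of _ _ _ _ "(+)"] sum.cong refl)
        (simp_all add: power_mult_distrib power_add mult_ac flip: cancel)
    also have "(\<Sum>k<n. cnj (b (Suc k) * (\<rho> * u) ^ Suc k)) = cnj (\<Sum>k<Suc n. b k * (\<rho> * u) ^ k)"
      by (subst shift) (simp_all add: b0)
    finally show ?thesis
      using B[of "\<rho> * u"] u \<rho> by (simp add: norm_mult norm_power del: sum.lessThan_Suc)
  qed
  have "real N * (\<Sum>m<N. (cmod (d m))\<^sup>2)
      = (\<Sum>j<N. (cmod (\<Sum>m<N. d m * cis (2 * pi * real j / real N) ^ m))\<^sup>2)"
    by (rule discrete_parseval[symmetric]) (simp add: N_def)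
  also have "\<dots> \<le> (\<Sum>j<N. B\<^sup>2)"
    by (intro sum_mono power_mono bound) auto
  finally have "(\<Sum>m<N. (cmod (d m))\<^sup>2) \<le> B\<^sup>2"
    by (simp add: N_def)
  moreover have "(\<Sum>m<N. (cmod (d m))\<^sup>2)
      = (\<Sum>k<Suc n. ((cmod (a k))\<^sup>2 + (cmod (b k))\<^sup>2) * (\<rho>\<^sup>2) ^ k)"
  proof -
    have sq: "(cmod (c * of_real (\<rho> ^ k)))\<^sup>2 = (cmod c)\<^sup>2 * (\<rho>\<^sup>2) ^ k" for c k
      using \<rho> by (simp add: norm_mult norm_power power_mult_distrib mult.commute flip: power_mult)
    have "(\<Sum>m<N. (cmod (d m))\<^sup>2)
        = (\<Sum>k<Suc n. (cmod (a k * of_real (\<rho> ^ k)))\<^sup>2) + (\<Sum>k<n. (cmod (cnj (b (Suc k)) * of_real (\<rho> ^ Suc k)))\<^sup>2)"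
      unfolding split by (auto simp: d_def intro!: arg_cong2[of _ _ _ _ "(+)"] sum.cong)
    also have "(\<Sum>k<n. (cmod (cnj (b (Suc k)) * of_real (\<rho> ^ Suc k)))\<^sup>2)
        = (\<Sum>k<Suc n. (cmod (b k))\<^sup>2 * (\<rho>\<^sup>2) ^ k)"
      unfolding sq by (subst shift) (simp_all add: b0)
    finally show ?thesis
      unfolding sq by (simp add: sum.distrib distrib_right del: sum.lessThan_Suc)
  qed
  ultimately show ?thesis by simp
qed

text \<open>The partial sums of the power series approximate \<open>f\<close> uniformly on each circle of radius
  \<open>\<rho> < 1\<close>, hence are bounded there by \<open>M + \<epsilon>\<close>; a fixed number of coefficients is kept while the
  degree of the approximation grows, and finally \<open>\<epsilon>\<close> tends to \<open>0\<close> and \<open>\<rho>\<close> to \<open>1\<close>.\<close>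

lemma harmonic_bessel:
  fixes h g :: "complex \<Rightarrow> complex" and a b :: "nat \<Rightarrow> complex" and M :: real
  assumes h: "\<And>z. cmod z < 1 \<Longrightarrow> (\<lambda>k. a k * z ^ k) sums h z"
    and g: "\<And>z. cmod z < 1 \<Longrightarrow> (\<lambda>k. b k * z ^ k) sums g z"
    and b0: "b 0 = 0"
    and M: "\<And>z. cmod z < 1 \<Longrightarrow> cmod (h z + cnj (g z)) \<le> M"
  shows "(\<Sum>k<n. (cmod (a k))\<^sup>2 + (cmod (b k))\<^sup>2) \<le> M\<^sup>2"
proof -
  define c where "c k = (cmod (a k))\<^sup>2 + (cmod (b k))\<^sup>2" for k
  have unif: "uniform_limit (cball 0 \<rho>) (\<lambda>N z. \<Sum>k<N. c k * z ^ k) F sequentially"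
    if c: "\<And>z. cmod z < 1 \<Longrightarrow> (\<lambda>k. c k * z ^ k) sums F z" and \<rho>: "0 \<le> \<rho>" "\<rho> < 1" for c F \<rho>
  proof -
    obtain s where s: "\<rho> < s" "s < 1" using dense \<rho>(2) by blast
    have "ereal \<rho> < ereal (cmod (of_real s))" using s \<rho> by simp
    also have "\<dots> \<le> conv_radius c"
      using c[of "of_real s"] s \<rho> by (intro conv_radius_geI sums_summable) auto
    finally have "uniform_limit (cball 0 \<rho>) (\<lambda>N z. \<Sum>k<N. c k * (z - 0) ^ k)
        (\<lambda>z. \<Sum>k. c k * (z - 0) ^ k) sequentially"
      by (rule powser_uniform_limit)
    then show ?thesis
      by (rule uniform_limit_cong'[THEN iffD1, rotated -1])
        (use c \<rho> in \<open>auto simp: sums_iff\<close>)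
  qed
  have disc: "(\<Sum>k<n. c k * (\<rho>\<^sup>2) ^ k) \<le> (M + e)\<^sup>2" if \<rho>: "0 \<le> \<rho>" "\<rho> < 1" and e: "e > 0" for \<rho> e
  proof -
    have "uniform_limit (cball 0 \<rho>)
        (\<lambda>N z. (\<Sum>k<N. a k * z ^ k) + cnj (\<Sum>k<N. b k * z ^ k))
        (\<lambda>z. h z + cnj (g z)) sequentially"
      by (intro uniform_limit_intros unif h g \<rho>)
    from uniform_limitD[OF this e] obtain N where N:
      "dist ((\<Sum>k<m. a k * z ^ k) + cnj (\<Sum>k<m. b k * z ^ k)) (h z + cnj (g z)) < e"
      if "m \<ge> N" "cmod z \<le> \<rho>" for m z
      unfolding eventually_sequentially by (metis mem_cball_0)
    define m where "m = max n N"
    have "cmod ((\<Sum>k<Suc m. a k * z ^ k) + cnj (\<Sum>k<Suc m. b k * z ^ k)) \<le> M + e"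
      if "cmod z = \<rho>" for z
    proof -
      have "dist ((\<Sum>k<Suc m. a k * z ^ k) + cnj (\<Sum>k<Suc m. b k * z ^ k)) (h z + cnj (g z)) < e"
        by (rule N) (use that in \<open>auto simp: m_def\<close>)
      moreover have "cmod (h z + cnj (g z)) \<le> M" using M that \<rho> by simp
      ultimately show ?thesis
        unfolding dist_norm by norm
    qed
    then have "(\<Sum>k<Suc m. c k * (\<rho>\<^sup>2) ^ k) \<le> (M + e)\<^sup>2"
      unfolding c_def using b0 \<rho>(1) by (intro harmonic_polynomial_bessel)
    moreover have "(\<Sum>k<n. c k * (\<rho>\<^sup>2) ^ k) \<le> (\<Sum>k<Suc m. c k * (\<rho>\<^sup>2) ^ k)"
      by (intro sum_mono2) (auto simp: m_def c_def)
    ultimately show ?thesis by linarith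
  qed
  have bound: "(\<Sum>k<n. c k * (\<rho>\<^sup>2) ^ k) \<le> M\<^sup>2" if "0 \<le> \<rho>" "\<rho> < 1" for \<rho>
  proof (rule tendsto_lowerbound)
    show "((\<lambda>e. (M + e)\<^sup>2) \<longlongrightarrow> M\<^sup>2) (at_right 0)"
      by (auto intro!: tendsto_eq_intros)
    show "\<forall>\<^sub>F e in at_right 0. (\<Sum>k<n. c k * (\<rho>\<^sup>2) ^ k) \<le> (M + e)\<^sup>2"
      using disc[OF that] by (auto simp: eventually_at_right_field intro: exI[of _ 1])
  qed simp
  have "(\<Sum>k<n. c k) \<le> M\<^sup>2"
  proof (rule tendsto_upperbound)
    show "((\<lambda>\<rho>. \<Sum>k<n. c k * (\<rho>\<^sup>2) ^ k) \<longlongrightarrow> (\<Sum>k<n. c k)) (at_left (1::real))"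
      by (auto intro!: tendsto_eq_intros)
    show "\<forall>\<^sub>F \<rho> in at_left (1::real). (\<Sum>k<n. c k * (\<rho>\<^sup>2) ^ k) \<le> M\<^sup>2"
      using bound by (auto simp: eventually_at_left_field intro: exI[of _ 0])
  qed simp
  then show ?thesis by (simp add: c_def)
qed

section \<open>The coefficient inequality\<close>

theorem theorem3:
  fixes f h g :: "complex \<Rightarrow> complex" and a b :: "nat \<Rightarrow> complex" and p r :: real
  assumes "harmonic_mapping_on f (ball 0 1)"
    and "h analytic_on ball 0 1" and "g analytic_on ball 0 1"
    and "\<And>z. z \<in> ball 0 1 \<Longrightarrow> f z = h z + cnj (g z)"
    and "\<And>z. z \<in> ball 0 1 \<Longrightarrow> cmod (f z) \<le> 1"
    and "\<And>z. z \<in> ball 0 1 \<Longrightarrow> (\<lambda>k. a k * z ^ k) sums h z"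
    and "\<And>z. z \<in> ball 0 1 \<Longrightarrow> (\<lambda>k. b (Suc k) * z ^ Suc k) sums g z"
    and "p \<ge> 1" and "0 \<le> r" and "r < 1"
  shows "summable (\<lambda>k. (cmod (a (Suc k)) powr p + cmod (b (Suc k)) powr p) powr (1 / p) * r ^ Suc k) \<and>
    (\<Sum>k. (cmod (a (Suc k)) powr p + cmod (b (Suc k)) powr p) powr (1 / p) * r ^ Suc k)
      \<le> max (2 powr (1 / p - 1 / 2)) 1 * sqrt (1 - (cmod (a 0))\<^sup>2) * (r / sqrt (1 - r\<^sup>2))"
proof -
  define K where "K = max (2 powr (1 / p - 1 / 2)) 1"
  define A where "A k = sqrt ((cmod (a (Suc k)))\<^sup>2 + (cmod (b (Suc k)))\<^sup>2)" for k
  define t where "t k = (cmod (a (Suc k)) powr p + cmod (b (Suc k)) powr p) powr (1 / p) * r ^ Suc k"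
    for k
  have K: "K \<ge> 1" by (simp add: K_def)
  have "r\<^sup>2 < 1" using assms(9,10) by (simp add: power_less_one_iff abs_square_less_1)
  (* The series for g starts at k = 1, so its constant coefficient is 0 whatever b 0 is. *)
  define b' where "b' = b(0 := 0)"
  have g: "(\<lambda>k. b' k * z ^ k) sums g z" if "cmod z < 1" for z
  proof -
    have "(\<lambda>k. b' (Suc k) * z ^ Suc k) sums g z"
      using assms(7)[of z] that by (simp add: b'_def)
    then show ?thesis
      using sums_Suc_iff[of "\<lambda>k. b' k * z ^ k" "g z"] by (simp add: b'_def)
  qed
  have A: "(\<Sum>k<n. (A k)\<^sup>2) \<le> 1 - (cmod (a 0))\<^sup>2" for n
  proof -
    have "(\<Sum>k<Suc n. (cmod (a k))\<^sup>2 + (cmod (b' k))\<^sup>2) \<le> 1\<^sup>2"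
      using assms(4-6) by (intro harmonic_bessel[where h = h and g = g] g) (auto simp: b'_def)
    then show ?thesis
      by (simp add: sum.lessThan_Suc_shift A_def b'_def del: sum.lessThan_Suc)
  qed
  have R: "(\<Sum>k<n. (r ^ Suc k)\<^sup>2) \<le> r\<^sup>2 / (1 - r\<^sup>2)" for n
  proof -
    have "(\<Sum>k<n. (r ^ Suc k)\<^sup>2) = r\<^sup>2 * (\<Sum>k<n. (r\<^sup>2) ^ k)"
      by (simp add: sum_distrib_left power_mult_distrib mult.commute flip: power_mult)
    also have "\<dots> = r\<^sup>2 * ((1 - (r\<^sup>2) ^ n) / (1 - r\<^sup>2))"
      using \<open>r\<^sup>2 < 1\<close> by (simp add: sum_gp_strict)
    also have "\<dots> \<le> r\<^sup>2 * (1 / (1 - r\<^sup>2))"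
      using \<open>r\<^sup>2 < 1\<close> by (intro mult_left_mono divide_right_mono) auto
    finally show ?thesis by simp
  qed
  have partial: "(\<Sum>k<n. t k) \<le> K * sqrt (1 - (cmod (a 0))\<^sup>2) * (r / sqrt (1 - r\<^sup>2))" for n
  proof -
    have "(\<Sum>k<n. t k) \<le> (\<Sum>k<n. K * A k * r ^ Suc k)"
      unfolding t_def K_def A_def using assms(8,9)
      by (intro sum_mono mult_right_mono lp_le_l2_pair) auto
    also have "\<dots> = K * (\<Sum>k<n. A k * r ^ Suc k)"
      by (simp add: sum_distrib_left mult.assoc)
    also have "\<dots> \<le> K * sqrt ((1 - (cmod (a 0))\<^sup>2) * (r\<^sup>2 / (1 - r\<^sup>2)))"
    proof (intro mult_left_mono real_le_rsqrt)
      have "(\<Sum>k<n. A k * r ^ Suc k)\<^sup>2 \<le> (\<Sum>k<n. (A k)\<^sup>2) * (\<Sum>k<n. (r ^ Suc k)\<^sup>2)"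
        by (rule Cauchy_Schwarz_ineq_sum)
      also have "\<dots> \<le> (1 - (cmod (a 0))\<^sup>2) * (r\<^sup>2 / (1 - r\<^sup>2))"
        using A[of 0] by (intro mult_mono A R sum_nonneg) auto
      finally show "(\<Sum>k<n. A k * r ^ Suc k)\<^sup>2 \<le> (1 - (cmod (a 0))\<^sup>2) * (r\<^sup>2 / (1 - r\<^sup>2))" .
    qed (use K in simp)
    also have "\<dots> = K * sqrt (1 - (cmod (a 0))\<^sup>2) * (r / sqrt (1 - r\<^sup>2))"
      using assms(9) by (simp add: real_sqrt_mult real_sqrt_divide)
    finally show ?thesis .
  qed
  have "summable t"
    using assms(9) by (intro summableI_nonneg_bounded[OF _ partial]) (simp add: t_def)
  moreover from this have "suminf t \<le> K * sqrt (1 - (cmod (a 0))\<^sup>2) * (r / sqrt (1 - r\<^sup>2))"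
    by (rule suminf_le_const) (rule partial)
  ultimately show ?thesis by (simp add: t_def[abs_def] K_def)
qed

end
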